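(* Let $n\ge 4$ be an integer. Then $$r_{\mathrm{u}}(n,C_n)> n/4.$$
   Context: $K_n$ is the complete graph on $n$ vertices and $C_n$ is the cycle on $n$ vertices, so a copy of $C_n$ in $K_n$ is a Hamilton cycle. An $r$-coloring of $K_n$ is a map $\chi:E(K_n)\to[r]=\{1,\dots,r\}$ (not necessarily proper or surjective). For a graph $H$, the unique-Ramsey number $r_{\mathrm{u}}(n,H)$ is the minimum positive integer $r$ for which there is an $r$-coloring of $K_n$ such that in every (not necessarily induced) copy of $H$ in $K_n$ some color occurs on exactly one edge of that copy. *)

theory Defs
  imports Complex_Main "HOL-Library.FuncSet"
begin

text \<open>
  Undirected graphs; an edge is the set of its two end vertices.
  Being a simple graph (every edge a two-element set of vertices) is not part of the type;
  it holds for \<open>complete_graph n\<close>, and for \<open>cycle_graph n\<close> when \<open>n \<ge> 3\<close>.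
\<close>

record 'a ugraph =
  vertices :: "'a set"
  edges :: "'a set set"

definition complete_graph :: "nat \<Rightarrow> nat ugraph" where
  "complete_graph n =
     \<lparr>vertices = {..<n}, edges = {{u, v} | u v. u < n \<and> v < n \<and> u \<noteq> v}\<rparr>"

definition cycle_graph :: "nat \<Rightarrow> nat ugraph" where
  "cycle_graph n =
     \<lparr>vertices = {..<n}, edges = {{i, (i + 1) mod n} | i. i < n}\<rparr>"

definition subgraph :: "'a ugraph \<Rightarrow> 'a ugraph \<Rightarrow> bool" where
  "subgraph F G \<longleftrightarrow> vertices F \<subseteq> vertices G \<and> edges F \<subseteq> edges G"

definition graph_iso :: "'a ugraph \<Rightarrow> 'b ugraph \<Rightarrow> bool" where
  "graph_iso H F \<longleftrightarrow>
     (\<exists>f. bij_betw f (vertices H) (vertices F) \<and> edges F = (\<lambda>e. f ` e) ` edges H)"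

definition is_copy :: "'a ugraph \<Rightarrow> 'b ugraph \<Rightarrow> 'b ugraph \<Rightarrow> bool" where
  "is_copy H G F \<longleftrightarrow> subgraph F G \<and> graph_iso H F"

definition edge_coloring :: "nat \<Rightarrow> 'a ugraph \<Rightarrow> ('a set \<Rightarrow> nat) \<Rightarrow> bool" where
  "edge_coloring r G \<chi> \<longleftrightarrow> \<chi> \<in> edges G \<rightarrow> {1..r}"

definition has_unique_color :: "('a set \<Rightarrow> nat) \<Rightarrow> 'a ugraph \<Rightarrow> bool" where
  "has_unique_color \<chi> F \<longleftrightarrow> (\<exists>c. \<exists>!e. e \<in> edges F \<and> \<chi> e = c)"

text \<open>
  The minimum exists as soon as \<open>H\<close> has an edge, since then an injective coloring of the
  complete graph qualifies.
\<close>

definition unique_ramsey :: "nat \<Rightarrow> 'a ugraph \<Rightarrow> nat" where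
  "unique_ramsey n H =
     (LEAST r. 0 < r \<and>
        (\<exists>\<chi>. edge_coloring r (complete_graph n) \<chi> \<and>
             (\<forall>F. is_copy H (complete_graph n) F \<longrightarrow> has_unique_color \<chi> F)))"

end

theory Submission imports Defs
begin

text \<open>
  Suppose \<open>K\<^sub>n\<close> is coloured with \<open>r \<le> n / 4\<close> colours. Choose vertex-disjoint pieces on at most four
  vertices, one for each colour in a set \<open>S\<close>, each containing two edges of its colour; maximise
  first \<open>|S|\<close>, then the number of pieces that are stars with three leaves. Let \<open>F\<close> be the linear
  forest formed by the pieces, \<open>W\<close> the set of at least \<open>4 t\<close> uncovered vertices and \<open>T\<close> the set of the
  \<open>t\<close> colours outside \<open>S\<close>. Exchanging pieces shows that a vertex of \<open>F\<close>-degree at most 1 sends at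
  most two edges of each colour of \<open>T\<close> to \<open>W\<close>.

  As long as two edges of the same colour in \<open>T\<close> can be added to the linear forest, add them and
  move that colour out of \<open>T\<close>. Once this is impossible, every colour of \<open>T\<close> touches at most two
  vertices of \<open>W\<close>, so at least \<open>2 t \<ge> t + 1\<close> vertices of \<open>W\<close> are untouched (if \<open>t > 0\<close>). A Hamilton
  path through the other vertices that contains \<open>F\<close> uses each colour of \<open>T\<close> at most once; putting an
  untouched vertex in place of each such edge, and the remaining ones between the two ends of the
  path, gives a Hamilton cycle that avoids \<open>T\<close> and uses every other colour at least twice.
\<close>

section \<open>Edges of paths and cycles\<close>

fun path_edges :: "'a list \<Rightarrow> 'a set set" where
  "path_edges [] = {}"
| "path_edges [x] = {}"
| "path_edges (x # y # zs) = insert {x, y} (path_edges (y # zs))"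

lemma path_edges_Cons:
  "path_edges (x # xs) = (if xs = [] then {} else insert {x, hd xs} (path_edges xs))"
  by (cases xs) auto

lemma path_edges_subset: "e \<in> path_edges xs \<Longrightarrow> e \<subseteq> set xs"
  by (induction xs rule: path_edges.induct) auto

lemma path_edges_split: "path_edges (p @ a # q) = path_edges (p @ [a]) \<union> path_edges (a # q)"
  by (induction p rule: path_edges.induct) (auto simp: path_edges_Cons)

lemma path_edges_append:
  "xs \<noteq> [] \<Longrightarrow> ys \<noteq> [] \<Longrightarrow>
    path_edges (xs @ ys) = insert {last xs, hd ys} (path_edges xs \<union> path_edges ys)"
  by (induction xs rule: path_edges.induct) (auto simp: path_edges_Cons)

lemma path_edges_append_supset: "path_edges xs \<union> path_edges ys \<subseteq> path_edges (xs @ ys)"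
  by (cases "xs = []"; cases "ys = []") (auto simp: path_edges_append)

lemma path_edges_concat: "xs \<in> set xss \<Longrightarrow> path_edges xs \<subseteq> path_edges (concat xss)"
proof (induction xss)
  case (Cons ys xss)
  then show ?case
    using path_edges_append_supset[of ys "concat xss"] by auto
qed simp

lemma path_edges_conv_nth:
  "path_edges xs = {{xs ! i, xs ! Suc i} | i. Suc i < length xs}"
proof (induction xs rule: path_edges.induct)
  case (3 x y zs)
  show ?case (is "?l = ?r")
  proof
    show "?l \<subseteq> ?r"
    proof
      fix e assume "e \<in> ?l"
      then consider "e = {x, y}" | "e \<in> path_edges (y # zs)" by auto
      then show "e \<in> ?r"
      proof cases
        case 1
        then show ?thesis by (auto intro!: exI[of _ 0])
      next
        case 2
        then obtain i where "Suc i < length (y # zs)" "e = {(y # zs) ! i, (y # zs) ! Suc i}"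
          using 3 by auto
        then show ?thesis by (auto intro!: exI[of _ "Suc i"])
      qed
    qed
    show "?r \<subseteq> ?l"
    proof
      fix e assume "e \<in> ?r"
      then obtain i where i: "Suc i < length (x # y # zs)"
        "e = {(x # y # zs) ! i, (x # y # zs) ! Suc i}" by auto
      show "e \<in> ?l"
      proof (cases i)
        case (Suc j)
        then have "e \<in> path_edges (y # zs)" unfolding 3 using i by auto
        then show ?thesis by simp
      qed (use i in auto)
    qed
  qed
qed auto

text \<open>Deleting vertices never separates neighbours that both survive. So vertices isolated in
  a forest can be moved elsewhere on a Hamilton path without losing forest edges.\<close>

lemma path_edges_filter:
  "e \<in> path_edges xs \<Longrightarrow> \<forall>v\<in>e. P v \<Longrightarrow> e \<in> path_edges (filter P xs)"
proof (induction xs rule: path_edges.induct)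
  case (3 x y zs)
  show ?case
  proof (cases "e = {x, y}")
    case False
    then have "e \<in> path_edges (filter P (y # zs))" using 3 by simp
    then show ?thesis
      using path_edges_append_supset[of "filter P [x]" "filter P (y # zs)"] by auto
  qed (use 3 in simp)
qed auto

lemma finite_path_edges: "finite (path_edges xs)"
  by (induction xs rule: path_edges.induct) auto

lemma path_edges_at_last:
  "distinct (p @ [a]) \<Longrightarrow> e \<in> path_edges (p @ [a]) \<Longrightarrow> a \<in> e \<Longrightarrow> e = {last p, a}"
  by (cases "p = []") (auto simp: path_edges_append dest: path_edges_subset)

lemma path_edges_at_hd:
  "distinct (a # q) \<Longrightarrow> e \<in> path_edges (a # q) \<Longrightarrow> a \<in> e \<Longrightarrow> e = {a, hd q}"
  by (cases "q = []") (auto simp: path_edges_Cons dest: path_edges_subset)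

lemma path_edges_insert:
  "path_edges (p @ a # w # b # q) = path_edges (p @ [a]) \<union> {{a, w}, {w, b}} \<union> path_edges (b # q)"
  using path_edges_split[of p a "w # b # q"] by auto

section \<open>Colours used exactly once, and cycles as vertex lists\<close>

definition unique_color :: "('a set \<Rightarrow> 'c) \<Rightarrow> 'a set set \<Rightarrow> 'c \<Rightarrow> bool" where
  "unique_color \<chi> E c \<longleftrightarrow> (\<exists>!e. e \<in> E \<and> \<chi> e = c)"

lemma not_unique_colorI:
  "e \<in> E \<Longrightarrow> f \<in> E \<Longrightarrow> e \<noteq> f \<Longrightarrow> \<chi> e = c \<Longrightarrow> \<chi> f = c \<Longrightarrow> \<not> unique_color \<chi> E c"
  unfolding unique_color_def by metis

lemma unique_colorE:
  assumes "unique_color \<chi> E c"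
  obtains e where "e \<in> E" "\<chi> e = c"
  using assms unfolding unique_color_def by metis

definition cycle_edges :: "'a list \<Rightarrow> 'a set set" where
  "cycle_edges xs = insert {last xs, hd xs} (path_edges xs)"

lemma cycle_edges_conv_nth:
  assumes "xs \<noteq> []"
  shows "cycle_edges xs = {{xs ! i, xs ! ((i + 1) mod length xs)} | i. i < length xs}"
    (is "_ = ?r")
proof
  let ?n = "length xs"
  have last: "{last xs, hd xs} = {xs ! (?n - 1), xs ! ((?n - 1 + 1) mod ?n)}"
    using assms by (simp add: last_conv_nth hd_conv_nth)
  show "cycle_edges xs \<subseteq> ?r"
    unfolding cycle_edges_def path_edges_conv_nth
  proof (intro insert_subsetI subsetI)
    show "{last xs, hd xs} \<in> ?r"
      using last assms by (intro CollectI exI[of _ "?n - 1"]) auto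
    fix e assume "e \<in> {{xs ! i, xs ! Suc i} | i. Suc i < ?n}"
    then obtain i where "Suc i < ?n" "e = {xs ! i, xs ! Suc i}" by auto
    then show "e \<in> ?r" by (intro CollectI exI[of _ i]) auto
  qed
  show "?r \<subseteq> cycle_edges xs"
  proof
    fix e assume "e \<in> ?r"
    then obtain i where i: "i < ?n" "e = {xs ! i, xs ! ((i + 1) mod ?n)}" by auto
    show "e \<in> cycle_edges xs"
    proof (cases "Suc i < ?n")
      case True
      then show ?thesis using i unfolding cycle_edges_def path_edges_conv_nth by auto
    next
      case False
      then have "i = ?n - 1" using i by simp
      then show ?thesis using i last unfolding cycle_edges_def by auto
    qed
  qed
qed

section \<open>Linear forests\<close>

text \<open>A disjoint union of paths, encoded by a Hamilton path of the complete graph on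
  \<open>V\<close> that contains it; this makes \<open>V\<close> finite and keeps a completion at
  hand.\<close>

definition linear_forest :: "'a set \<Rightarrow> 'a set set \<Rightarrow> bool" where
  "linear_forest V F \<longleftrightarrow> (\<exists>xs. distinct xs \<and> set xs = V \<and> F \<subseteq> path_edges xs)"

definition isolated_in :: "'a set set \<Rightarrow> 'a \<Rightarrow> bool" where
  "isolated_in F v \<longleftrightarrow> (\<forall>e\<in>F. v \<notin> e)"

text \<open>Degree at most 1: the vertices of a linear forest where a new edge may be
  attached.\<close>

definition low_degree :: "'a set set \<Rightarrow> 'a \<Rightarrow> bool" where
  "low_degree F v \<longleftrightarrow> (\<forall>e\<in>F. \<forall>f\<in>F. v \<in> e \<longrightarrow> v \<in> f \<longrightarrow> e = f)"

lemma low_degreeD: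
  "low_degree F v \<Longrightarrow> e \<in> F \<Longrightarrow> f \<in> F \<Longrightarrow> v \<in> e \<Longrightarrow> v \<in> f \<Longrightarrow> e = f"
  unfolding low_degree_def by blast

lemma low_degree_mono: "low_degree F v \<Longrightarrow> G \<subseteq> F \<Longrightarrow> low_degree G v"
  unfolding low_degree_def by blast

lemma isolated_imp_low_degree: "isolated_in F v \<Longrightarrow> low_degree F v"
  unfolding isolated_in_def low_degree_def by blast

text \<open>Take the isolated \<open>w\<close> out of the Hamilton path and put it back next to
  \<open>a\<close>, on a side where no edge of \<open>F\<close> leaves \<open>a\<close>. Such a side
  exists because \<open>a\<close> has degree at most 1.\<close>

lemma linear_forest_add_edge:
  assumes "linear_forest V F" "w \<in> V" "isolated_in F w" "a \<in> V" "low_degree F a" "a \<noteq> w"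
  shows "linear_forest V (insert {a, w} F)"
proof -
  obtain xs where xs: "distinct xs" "set xs = V" "F \<subseteq> path_edges xs"
    using assms(1) unfolding linear_forest_def by blast
  define ys where "ys = filter (\<lambda>v. v \<noteq> w) xs"
  have F: "F \<subseteq> path_edges ys"
    using xs(3) assms(3) unfolding ys_def isolated_in_def
    by (auto intro!: path_edges_filter)
  have ys: "distinct ys" "set ys = V - {w}" using xs unfolding ys_def by auto
  then have "a \<in> set ys" using assms by auto
  then obtain p q where pq: "ys = p @ a # q" by (auto dest: split_list)
  have split: "path_edges ys = path_edges (p @ [a]) \<union> path_edges (a # q)"
    unfolding pq by (rule path_edges_split)
  show ?thesis
  proof (cases "q = [] \<or> {a, hd q} \<notin> F")
    case True
    have "path_edges (p @ a # w # q) = path_edges (p @ [a]) \<union> path_edges (a # w # q)"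
      by (rule path_edges_split)
    then have "insert {a, w} F \<subseteq> path_edges (p @ a # w # q)"
      using F split True by (auto simp: path_edges_Cons split: if_splits)
    moreover have "distinct (p @ a # w # q)" "set (p @ a # w # q) = V"
      using ys pq assms by auto
    ultimately show ?thesis unfolding linear_forest_def by blast
  next
    case False
    have p: "p = [] \<or> {last p, a} \<notin> F"
    proof (rule ccontr)
      assume *: "\<not> ?thesis"
      then have "{last p, a} = {a, hd q}"
        using False assms(5) unfolding low_degree_def by auto
      moreover have "last p \<in> set p" "hd q \<in> set q" using * False by auto
      ultimately show False using ys(1) pq by (auto simp: doubleton_eq_iff)
    qed
    have "path_edges (p @ w # a # q) = path_edges (p @ [w]) \<union> path_edges (w # a # q)"
      by (rule path_edges_split)
    then have "insert {a, w} F \<subseteq> path_edges (p @ w # a # q)"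
      using F split p
      by (cases "p = []") (auto simp: path_edges_append insert_commute)
    moreover have "distinct (p @ w # a # q)" "set (p @ w # a # q) = V"
      using ys pq assms by auto
    ultimately show ?thesis unfolding linear_forest_def by blast
  qed
qed

text \<open>The edges are added one after the other. After the first, \<open>w'\<close> is still
  isolated if \<open>v \<noteq> w'\<close>, and \<open>v'\<close> still has degree at most 1, even
  if \<open>v' = w\<close>. If \<open>v = w'\<close>, the reverse order works, since
  \<open>v' = w\<close> would make the edges equal.\<close>

lemma linear_forest_add_two_edges:
  assumes F: "linear_forest V F"
    and w: "w \<in> V" "isolated_in F w" "w' \<in> V" "isolated_in F w'" "w \<noteq> w'"
    and v: "v \<in> V" "low_degree F v" "v' \<in> V" "low_degree F v'" "v \<noteq> v'"
    and ne: "v \<noteq> w" "v' \<noteq> w'" "{v, w} \<noteq> {v', w'}"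
  shows "linear_forest V (F \<union> {{v, w}, {v', w'}})"
proof -
  have *: "linear_forest V (F \<union> {{v, w}, {v', w'}})"
    if w: "w \<in> V" "isolated_in F w" "w' \<in> V" "isolated_in F w'" "w \<noteq> w'"
    and v: "v \<in> V" "low_degree F v" "v' \<in> V" "low_degree F v'" "v \<noteq> v'"
    and ne: "v \<noteq> w" "v' \<noteq> w'" "v \<noteq> w'" for v w v' w'
  proof -
    have "linear_forest V (insert {v, w} F)"
      by (rule linear_forest_add_edge) (use F that in auto)
    then have "linear_forest V (insert {v', w'} (insert {v, w} F))"
    proof (rule linear_forest_add_edge)
      show "isolated_in (insert {v, w} F) w'" using w ne unfolding isolated_in_def by auto
      show "low_degree (insert {v, w} F) v'"
      proof (cases "v' = w")
        case True
        then show ?thesis using w unfolding low_degree_def isolated_in_def by auto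
      next
        case False
        then show ?thesis using v unfolding low_degree_def by auto
      qed
    qed (use that in auto)
    then show ?thesis by (simp add: insert_commute)
  qed
  show ?thesis
  proof (cases "v = w'")
    case False
    then show ?thesis using assms * by blast
  next
    case True
    then have "v' \<noteq> w" using ne by auto
    then have "linear_forest V (F \<union> {{v', w'}, {v, w}})"
      using assms by (intro *) auto
    then show ?thesis by (simp add: insert_commute)
  qed
qed

section \<open>Completing a linear forest to a Hamilton cycle\<close>

text \<open>Removing the path edge \<open>{a, b}\<close> leaves two paths that together contain
  \<open>F\<close>, one ending in \<open>a\<close>, the other starting in \<open>b\<close>.\<close>

lemma low_degree_at_non_forest_edge:
  assumes "distinct (p @ a # b # q)" "F \<subseteq> path_edges (p @ a # b # q)" "{a, b} \<notin> F"
  shows "low_degree F a" "low_degree F b"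
proof -
  have *: "e \<in> path_edges (p @ [a]) \<or> e \<in> path_edges (b # q)" if "e \<in> F" for e
    using that assms(2,3) path_edges_split[of p a "b # q"] by auto
  have a: "e = {last p, a}" if "e \<in> F" "a \<in> e" for e
  proof (rule path_edges_at_last)
    show "e \<in> path_edges (p @ [a])"
      using *[OF that(1)] that(2) assms(1) by (auto dest!: path_edges_subset)
  qed (use that assms in auto)
  have b: "e = {b, hd q}" if "e \<in> F" "b \<in> e" for e
  proof (rule path_edges_at_hd)
    show "e \<in> path_edges (b # q)"
      using *[OF that(1)] that(2) assms(1) by (auto dest!: path_edges_subset)
  qed (use that assms in auto)
  show "low_degree F a" unfolding low_degree_def using a by blast
  show "low_degree F b" unfolding low_degree_def using b by blast
qed

lemma low_degree_path_ends:
  assumes "distinct xs" "F \<subseteq> path_edges xs" "xs \<noteq> []"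
  shows "low_degree F (hd xs)" "low_degree F (last xs)"
proof -
  obtain a q where "xs = a # q" using assms by (cases xs) auto
  then show "low_degree F (hd xs)"
    using assms path_edges_at_hd[of a q] unfolding low_degree_def
    by (metis list.sel(1) subsetD)
  obtain p b where "xs = p @ [b]" using assms by (cases xs rule: rev_cases) auto
  then show "low_degree F (last xs)"
    using assms path_edges_at_last[of p b] unfolding low_degree_def
    by (metis last_snoc subsetD)
qed

text \<open>A path edge with colour in \<open>T\<close> is not in \<open>F\<close>, so its ends have
  degree at most 1. By \<open>good\<close>, inserting a vertex of \<open>R\<close> between them
  replaces it by two edges with colours outside \<open>T\<close>. Each round uses up one bad edge
  and one vertex of \<open>R\<close>, so the strict inequality persists and some vertex is left at
  the end.\<close>

lemma replace_bad_edges: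
  assumes "distinct ys" "F \<subseteq> path_edges ys" "\<And>e. e \<in> F \<Longrightarrow> \<chi> e \<notin> T"
    and "finite R" "set ys \<inter> R = {}" "R \<subseteq> R0"
    and good: "\<And>v w. w \<in> R0 \<Longrightarrow> low_degree F v \<Longrightarrow> v \<in> V \<Longrightarrow> v \<noteq> w \<Longrightarrow> \<chi> {v, w} \<notin> T"
    and "set ys \<union> R = V"
    and "card {e \<in> path_edges ys. \<chi> e \<in> T} < card R"
  shows "\<exists>zs R'. distinct zs \<and> F \<subseteq> path_edges zs \<and> finite R' \<and> R' \<noteq> {} \<and> R' \<subseteq> R0 \<and>
    set zs \<inter> R' = {} \<and> set zs \<union> R' = V \<and> (\<forall>e\<in>path_edges zs. \<chi> e \<notin> T)"
  using assms(1,2,4-6,8,9)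
proof (induction "card {e \<in> path_edges ys. \<chi> e \<in> T}" arbitrary: ys R rule: less_induct)
  case less
  show ?case
  proof (cases "\<forall>e\<in>path_edges ys. \<chi> e \<notin> T")
    case True
    moreover have "R \<noteq> {}" using less.prems(7) by auto
    ultimately show ?thesis using less.prems by blast
  next
    case False
    then obtain i where i: "Suc i < length ys" "\<chi> {ys ! i, ys ! Suc i} \<in> T"
      unfolding path_edges_conv_nth by auto
    define p a b q where "p = take i ys" and "a = ys ! i" and "b = ys ! Suc i"
      and "q = drop (Suc (Suc i)) ys"
    have ys: "ys = p @ a # b # q"
      using i unfolding p_def a_def b_def q_def
      by (metis Cons_nth_drop_Suc Suc_lessD id_take_nth_drop)
    have ab: "\<chi> {a, b} \<in> T" using i a_def b_def by auto
    then have "{a, b} \<notin> F" using assms(3) by blast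
    then have low: "low_degree F a" "low_degree F b"
      using low_degree_at_non_forest_edge less.prems(1,2) unfolding ys by metis+
    obtain w where w: "w \<in> R" using less.prems(7) by fastforce
    let ?zs = "p @ a # w # b # q"
    have aw: "\<chi> {a, w} \<notin> T" and wb: "\<chi> {w, b} \<notin> T"
      using good[of w a] good[of w b] low w less.prems(4,5,6) ys by (auto simp: insert_commute)
    have old: "path_edges ys = path_edges (p @ [a]) \<union> {{a, b}} \<union> path_edges (b # q)"
      unfolding ys using path_edges_split[of p a "b # q"] by auto
    have d: "distinct ?zs" using less.prems(1,4) w unfolding ys by auto
    \<comment> \<open>By distinctness the bad edge occurs only once on the path, so the insertion
      really removes it.\<close>
    have "{a, b} \<notin> path_edges (p @ [a])" "{a, b} \<notin> path_edges (b # q)"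
      using d by (auto dest!: path_edges_subset)
    then have sub: "{e \<in> path_edges ?zs. \<chi> e \<in> T} = {e \<in> path_edges ys. \<chi> e \<in> T} - {{a, b}}"
      using aw wb unfolding path_edges_insert old by auto
    have "{a, b} \<in> {e \<in> path_edges ys. \<chi> e \<in> T}" using ab old by auto
    then have smaller: "Suc (card {e \<in> path_edges ?zs. \<chi> e \<in> T}) = card {e \<in> path_edges ys. \<chi> e \<in> T}"
      unfolding sub by (intro card_Suc_Diff1) (auto simp: finite_path_edges)
    have cR: "Suc (card (R - {w})) = card R" using w less.prems(3) by (rule_tac card_Suc_Diff1)
    show ?thesis
    proof (rule less.hyps)
      show "card {e \<in> path_edges ?zs. \<chi> e \<in> T} < card {e \<in> path_edges ys. \<chi> e \<in> T}"
        using smaller by simp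
      show "distinct ?zs" by (rule d)
      show "F \<subseteq> path_edges ?zs"
        using less.prems(2) \<open>{a, b} \<notin> F\<close> unfolding path_edges_insert old by auto
      show "finite (R - {w})" using less.prems(3) by simp
      show "set ?zs \<inter> (R - {w}) = {}" "set ?zs \<union> (R - {w}) = V" "R - {w} \<subseteq> R0"
        using less.prems w ys by auto
      show "card {e \<in> path_edges ?zs. \<chi> e \<in> T} < card (R - {w})"
        using smaller cR less.prems(7) by simp
    qed
  qed
qed

section \<open>Vertices touched by a colour that cannot be added\<close>

lemma card_le_2I:
  assumes "\<And>x y z. x \<in> A \<Longrightarrow> y \<in> A \<Longrightarrow> z \<in> A \<Longrightarrow> x \<noteq> y \<Longrightarrow> y \<noteq> z \<Longrightarrow> x \<noteq> z \<Longrightarrow> False"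
  shows "card A \<le> 2"
proof (rule ccontr)
  assume "\<not> ?thesis"
  then have "3 \<le> card A" by simp
  then obtain B where "B \<subseteq> A" "card B = 3" by (meson obtain_subset_with_card_n)
  then show False using assms unfolding card_3_iff by blast
qed

lemma card_gt_2E:
  assumes "\<not> card A \<le> 2"
  obtains x y z where "x \<in> A" "y \<in> A" "z \<in> A" "x \<noteq> y" "y \<noteq> z" "x \<noteq> z"
  using assms card_le_2I[of A] by blast

text \<open>Two different edges of colour \<open>c\<close> with different ends in \<open>W\<close>
  and different other ends would both fit into the forest, against \<open>sat\<close>. Three touched
  vertices with one common partner are excluded by \<open>few\<close>.\<close>

lemma card_touched_le_2:
  assumes F: "linear_forest V F" and W: "W \<subseteq> V" "\<And>w. w \<in> W \<Longrightarrow> isolated_in F w"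
    and "finite W"
    and few: "\<And>v. v \<in> V \<Longrightarrow> low_degree F v \<Longrightarrow> card {w \<in> W. w \<noteq> v \<and> \<chi> {v, w} = c} \<le> 2"
    and sat: "\<And>e f. e \<noteq> f \<Longrightarrow> \<chi> e = c \<Longrightarrow> \<chi> f = c \<Longrightarrow> \<not> linear_forest V (F \<union> {e, f})"
  shows "card {w \<in> W. \<exists>v\<in>V. v \<noteq> w \<and> low_degree F v \<and> \<chi> {v, w} = c} \<le> 2"
    (is "card ?B \<le> 2")
proof (rule card_le_2I)
  have same: "{v, w} = {v', w'}"
    if "w \<in> W" "w' \<in> W" "w \<noteq> w'" "v \<noteq> v'" "v \<in> V" "v' \<in> V" "v \<noteq> w" "v' \<noteq> w'"
      "low_degree F v" "low_degree F v'" "\<chi> {v, w} = c" "\<chi> {v', w'} = c" for v w v' w'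
  proof (rule ccontr)
    assume "{v, w} \<noteq> {v', w'}"
    moreover from this have "linear_forest V (F \<union> {{v, w}, {v', w'}})"
      using that W by (intro linear_forest_add_two_edges[OF F]) auto
    ultimately show False using sat[of "{v, w}" "{v', w'}"] that by simp
  qed
  fix x y z
  assume B: "x \<in> ?B" "y \<in> ?B" "z \<in> ?B" and ne: "x \<noteq> y" "y \<noteq> z" "x \<noteq> z"
  obtain a where a: "x \<in> W" "a \<in> V" "a \<noteq> x" "low_degree F a" "\<chi> {a, x} = c" using B by blast
  obtain b where b: "y \<in> W" "b \<in> V" "b \<noteq> y" "low_degree F b" "\<chi> {b, y} = c" using B by blast
  obtain d where d: "z \<in> W" "d \<in> V" "d \<noteq> z" "low_degree F d" "\<chi> {d, z} = c" using B by blast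
  have ab: "a \<noteq> b \<Longrightarrow> {a, x} = {b, y}" and bd: "b \<noteq> d \<Longrightarrow> {b, y} = {d, z}"
    and ad: "a \<noteq> d \<Longrightarrow> {a, x} = {d, z}"
    using same[of x y a b] same[of y z b d] same[of x z a d] a b d ne by simp_all
  show False
  proof (cases "a = b \<and> b = d")
    case True
    then have "{x, y, z} \<subseteq> {w \<in> W. w \<noteq> a \<and> \<chi> {a, w} = c}" using a b d by auto
    then have "card {x, y, z} \<le> card {w \<in> W. w \<noteq> a \<and> \<chi> {a, w} = c}"
      using \<open>finite W\<close> by (intro card_mono) auto
    then show False using few[of a] a ne by simp
  next
    case False
    \<comment> \<open>Two different partners force a common edge such as \<open>{x, y}\<close>. The
      third partner differs from one of them, which would force the third touched vertex into that
      edge as well.\<close>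
    then show False using ab bd ad ne a b d by (auto simp: doubleton_eq_iff)
  qed
qed

text \<open>The hypotheses are the invariant of an induction on \<open>card T\<close>. Moving a
  colour out of \<open>T\<close> adds two edges to \<open>F\<close> and costs at most four vertices
  of \<open>W\<close>; a larger \<open>F\<close> has no new vertices of degree at most 1, so the
  last bound is inherited.\<close>

lemma extend_to_hamilton_cycle:
  assumes "linear_forest V F" "W \<subseteq> V" "2 \<le> card V"
    and "\<And>w. w \<in> W \<Longrightarrow> isolated_in F w"
    and "finite T" "4 * card T \<le> card W" "\<And>e. e \<in> F \<Longrightarrow> \<chi> e \<notin> T"
    and "\<And>v c. v \<in> V \<Longrightarrow> low_degree F v \<Longrightarrow> c \<in> T \<Longrightarrow>
           card {w \<in> W. w \<noteq> v \<and> \<chi> {v, w} = c} \<le> 2"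
  shows "\<exists>xs. distinct xs \<and> set xs = V \<and> F \<subseteq> cycle_edges xs \<and>
    (\<forall>c\<in>T. \<not> unique_color \<chi> (cycle_edges xs) c)"
  using assms
proof (induction "card T" arbitrary: T F W rule: less_induct)
  case less
  note F = less.prems(1) and W = less.prems(2) and iso = less.prems(4) and fT = less.prems(5)
    and cT = less.prems(6) and clean = less.prems(7) and few = less.prems(8)
  have finV: "finite V" using F unfolding linear_forest_def by auto
  then have finW: "finite W" using W finite_subset by blast
  show ?case
  proof (cases "\<exists>c\<in>T. \<exists>e f. e \<noteq> f \<and> \<chi> e = c \<and> \<chi> f = c \<and> linear_forest V (F \<union> {e, f})")
    case True
    then obtain c e f where c: "c \<in> T" and ef: "e \<noteq> f" "\<chi> e = c" "\<chi> f = c"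
      "linear_forest V (F \<union> {e, f})" by blast
    let ?F = "F \<union> {e, f}" and ?W = "W - (e \<union> f)" and ?T = "T - {c}"
    have ecard: "finite e \<and> card e \<le> 2" "finite f \<and> card f \<le> 2"
      using ef(4) unfolding linear_forest_def path_edges_conv_nth
      by (auto simp: card_insert_if)
    then have "card (e \<union> f) \<le> 4" using card_Un_le[of e f] by linarith
    then have cW: "card W \<le> card ?W + 4"
      using diff_card_le_card_Diff[of "e \<union> f" W] ecard by auto
    have cT': "Suc (card ?T) = card T" using c fT by (rule_tac card_Suc_Diff1)
    have "\<exists>xs. distinct xs \<and> set xs = V \<and> ?F \<subseteq> cycle_edges xs \<and>
      (\<forall>c\<in>?T. \<not> unique_color \<chi> (cycle_edges xs) c)"
    proof (rule less.hyps)
      show "isolated_in ?F w" if "w \<in> ?W" for w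
        using iso[of w] that unfolding isolated_in_def by auto
      show "card {w \<in> ?W. w \<noteq> v \<and> \<chi> {v, w} = d} \<le> 2"
        if "v \<in> V" "low_degree ?F v" "d \<in> ?T" for v d
      proof -
        have "card {w \<in> ?W. w \<noteq> v \<and> \<chi> {v, w} = d} \<le> card {w \<in> W. w \<noteq> v \<and> \<chi> {v, w} = d}"
          using finW by (intro card_mono) auto
        also have "\<dots> \<le> 2"
          using that by (intro few) (auto intro: low_degree_mono)
        finally show ?thesis .
      qed
    qed (use ef less.prems cW cT' in auto)
    then obtain xs where xs: "distinct xs" "set xs = V" "?F \<subseteq> cycle_edges xs"
      "\<forall>c\<in>?T. \<not> unique_color \<chi> (cycle_edges xs) c" by blast
    have "\<not> unique_color \<chi> (cycle_edges xs) c"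
      using xs(3) ef(1-3) by (intro not_unique_colorI[of e _ f]) auto
    then show ?thesis using xs by blast
  next
    case False
    then have sat: "\<not> linear_forest V (F \<union> {e, f})" if "\<chi> e \<in> T" "\<chi> e = \<chi> f" "e \<noteq> f" for e f
      using that by metis
    obtain xs where xs: "distinct xs" "set xs = V" "F \<subseteq> path_edges xs"
      using F unfolding linear_forest_def by blast
    show ?thesis
    proof (cases "T = {}")
      case True
      then show ?thesis using xs unfolding cycle_edges_def by auto
    next
      case False
      \<comment> \<open>Touching refers only to edges whose other end has degree at most 1, because
        new edges will be attached only at such vertices.\<close>
      define B where "B c = {w \<in> W. \<exists>v\<in>V. v \<noteq> w \<and> low_degree F v \<and> \<chi> {v, w} = c}" for c
      define R0 where "R0 = W - (\<Union>c\<in>T. B c)"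
      have "card (B c) \<le> 2" if "c \<in> T" for c
        unfolding B_def
      proof (rule card_touched_le_2[OF F W iso finW])
        show "\<not> linear_forest V (F \<union> {e, f})" if "e \<noteq> f" "\<chi> e = c" "\<chi> f = c" for e f
          using sat that \<open>c \<in> T\<close> by simp
      qed (use few that in auto)
      then have "card (\<Union>c\<in>T. B c) \<le> 2 * card T"
        using card_UN_le[OF fT, of B] sum_mono[of T "\<lambda>c. card (B c)" "\<lambda>_. 2"] by simp
      moreover have "card W - card (\<Union>c\<in>T. B c) \<le> card R0"
        unfolding R0_def using finW by (intro diff_card_le_card_Diff)
          (auto intro: finite_subset[of _ W] simp: B_def fT)
      moreover have "card T > 0" using False fT by auto
      \<comment> \<open>At least \<open>2 * card T\<close> vertices are untouched, which for
        nonempty \<open>T\<close> exceeds \<open>card T\<close>: one for each bad edge, and one more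
        to close the cycle.\<close>
      ultimately have R0: "card T < card R0" using cT by linarith
      have R0W: "R0 \<subseteq> W" and finR0: "finite R0" using finW unfolding R0_def by auto
      have good: "\<chi> {v, w} \<notin> T" if "w \<in> R0" "low_degree F v" "v \<in> V" "v \<noteq> w" for v w
        using that unfolding R0_def B_def by blast
      define ys where "ys = filter (\<lambda>v. v \<notin> R0) xs"
      have Fys: "F \<subseteq> path_edges ys"
        using xs(3) iso R0W unfolding ys_def isolated_in_def
        by (auto intro!: path_edges_filter)
      have ys: "distinct ys" "set ys = V - R0" using xs unfolding ys_def by auto
      \<comment> \<open>Two edges of \<open>ys\<close> with the same colour in \<open>T\<close>
        could be added to \<open>F\<close>, because \<open>ys\<close> followed by \<open>R0\<close>
        is a Hamilton path. So each colour of \<open>T\<close> occurs at most once on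
        \<open>ys\<close>.\<close>
      have "inj_on \<chi> {e \<in> path_edges ys. \<chi> e \<in> T}"
      proof (rule inj_onI, rule ccontr)
        fix e f assume ef: "e \<in> {e \<in> path_edges ys. \<chi> e \<in> T}" "f \<in> {e \<in> path_edges ys. \<chi> e \<in> T}"
          "\<chi> e = \<chi> f" "e \<noteq> f"
        obtain rs where rs: "set rs = R0" "distinct rs"
          using finR0 finite_distinct_list by blast
        have "distinct (ys @ rs)" "set (ys @ rs) = V" using ys rs R0W W by auto
        moreover have "F \<union> {e, f} \<subseteq> path_edges (ys @ rs)"
          using Fys ef path_edges_append_supset[of ys rs] by auto
        ultimately have "linear_forest V (F \<union> {e, f})" unfolding linear_forest_def by blast
        then show False using sat[OF _ ef(3,4)] ef(1) by blast
      qed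
      then have "card {e \<in> path_edges ys. \<chi> e \<in> T} \<le> card T"
        by (rule card_inj_on_le) (use fT in blast)+
      then have "card {e \<in> path_edges ys. \<chi> e \<in> T} < card R0" using R0 by simp
      then have "\<exists>zs R'. distinct zs \<and> F \<subseteq> path_edges zs \<and> finite R' \<and> R' \<noteq> {} \<and> R' \<subseteq> R0 \<and>
          set zs \<inter> R' = {} \<and> set zs \<union> R' = V \<and> (\<forall>e\<in>path_edges zs. \<chi> e \<notin> T)"
        by (intro replace_bad_edges[where \<chi> = \<chi> and T = T, OF ys(1) Fys clean finR0 _ subset_refl good])
          (use ys R0W W in auto)
      then obtain zs R where zs: "distinct zs" "F \<subseteq> path_edges zs" "finite R" "R \<noteq> {}" "R \<subseteq> R0"
        "set zs \<inter> R = {}" "set zs \<union> R = V" "\<forall>e\<in>path_edges zs. \<chi> e \<notin> T" by blast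
      \<comment> \<open>The leftover vertices \<open>R\<close> close \<open>zs\<close> up to a
        cycle. Every edge so added has one end in \<open>R\<close>, and its other end has degree at
        most 1, being in \<open>R\<close> or an end of a path containing \<open>F\<close>; hence
        \<open>good\<close> applies.\<close>
      obtain rs where rs: "set rs = R" "distinct rs"
        using zs(3) finite_distinct_list by blast
      then have rsne: "rs \<noteq> []" using zs by auto
      let ?xs = "zs @ rs"
      have d: "distinct ?xs" "set ?xs = V" using zs rs by auto
      have Fx: "F \<subseteq> path_edges ?xs" using zs(2) path_edges_append_supset[of zs rs] by blast
      have lowR: "low_degree F v" if "v \<in> R" for v
        by (rule isolated_imp_low_degree, rule iso) (use that zs(5) R0W in blast)
      have inrs: "\<chi> e \<notin> T" if "e \<in> path_edges rs" for e
      proof -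
        obtain i where i: "Suc i < length rs" "e = {rs ! i, rs ! Suc i}"
          using \<open>e \<in> path_edges rs\<close> unfolding path_edges_conv_nth by auto
        then have "rs ! i \<in> R" "rs ! Suc i \<in> R" "rs ! i \<noteq> rs ! Suc i"
          using rs by (auto simp: nth_eq_iff_index_eq)
        then show ?thesis using good[of "rs ! Suc i" "rs ! i"] lowR[of "rs ! i"] zs(5,7) i(2) by auto
      qed
      have "\<chi> {last zs, hd rs} \<notin> T" if "zs \<noteq> []"
      proof (rule good)
        have "hd rs \<in> R" "last zs \<in> set zs" using rs(1) rsne that by auto
        then show "hd rs \<in> R0" "last zs \<in> V" "last zs \<noteq> hd rs" using zs(5-7) by auto
        show "low_degree F (last zs)"
          using low_degree_path_ends(2)[OF zs(1,2) that] .
      qed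
      then have path: "\<chi> e \<notin> T" if "e \<in> path_edges ?xs" for e
        using that zs(8) inrs rsne by (cases "zs = []") (auto simp: path_edges_append)
      have "\<chi> {hd ?xs, last ?xs} \<notin> T"
      proof (rule good)
        show "last ?xs \<in> R0" using rs rsne zs by auto
        show "hd ?xs \<in> V" using d(2) rsne hd_in_set[of ?xs] by blast
        show "low_degree F (hd ?xs)"
          using low_degree_path_ends(1)[OF d(1) Fx] rsne by simp
        \<comment> \<open>\<open>2 \<le> card V\<close> keeps the closing edge from being a
          loop.\<close>
        have "2 \<le> length ?xs" using d less.prems(3) distinct_card[OF d(1)] by simp
        then show "hd ?xs \<noteq> last ?xs"
          using d(1) by (cases ?xs) (auto split: if_splits)
      qed
      then have "\<forall>e\<in>cycle_edges ?xs. \<chi> e \<notin> T"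
        using path unfolding cycle_edges_def by (auto simp: insert_commute)
      moreover have "F \<subseteq> cycle_edges ?xs" using Fx unfolding cycle_edges_def by auto
      ultimately show ?thesis
        using d by (intro exI[of _ ?xs]) (auto elim: unique_colorE)
    qed
  qed
qed

section \<open>Systems of monochromatic pieces\<close>

text \<open>Two edges, adjacent or disjoint, lie on a path with at most four vertices. Its remaining
  edges may have any colour.\<close>

definition pair_piece :: "('a set \<Rightarrow> 'c) \<Rightarrow> 'c \<Rightarrow> 'a list \<Rightarrow> bool" where
  "pair_piece \<chi> c l \<longleftrightarrow> distinct l \<and> length l \<le> 4 \<and>
     (\<exists>e f. e \<noteq> f \<and> e \<in> path_edges l \<and> f \<in> path_edges l \<and> \<chi> e = c \<and> \<chi> f = c)"

text \<open>The fourth vertex \<open>y\<close> is a spare leaf, which may replace \<open>u\<close> or \<open>w\<close>.\<close>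

definition star_piece :: "('a set \<Rightarrow> 'c) \<Rightarrow> 'c \<Rightarrow> 'a list \<Rightarrow> bool" where
  "star_piece \<chi> c l \<longleftrightarrow>
     (\<exists>u x w y. l = [u, x, w, y] \<and> \<chi> {x, u} = c \<and> \<chi> {x, w} = c \<and> \<chi> {x, y} = c)"

definition piece_system ::
    "('a set \<Rightarrow> 'c) \<Rightarrow> 'a set \<Rightarrow> 'c set \<Rightarrow> 'c set \<Rightarrow> ('c \<Rightarrow> 'a list) \<Rightarrow> bool" where
  "piece_system \<chi> V C S L \<longleftrightarrow> S \<subseteq> C \<and>
     (\<forall>c\<in>S. pair_piece \<chi> c (L c) \<and> set (L c) \<subseteq> V) \<and>
     (\<forall>c\<in>S. \<forall>d\<in>S. c \<noteq> d \<longrightarrow> set (L c) \<inter> set (L d) = {})"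

definition covered :: "'c set \<Rightarrow> ('c \<Rightarrow> 'a list) \<Rightarrow> 'a set" where
  "covered S L = (\<Union>c\<in>S. set (L c))"

text \<open>Keeping only the edges in the colour of their piece makes the forest avoid all colours
  outside \<open>S\<close>, while in a piece system each colour of \<open>S\<close> keeps at least
  two edges.\<close>

definition system_forest :: "('a set \<Rightarrow> 'c) \<Rightarrow> 'c set \<Rightarrow> ('c \<Rightarrow> 'a list) \<Rightarrow> 'a set set" where
  "system_forest \<chi> S L = (\<Union>c\<in>S. {e \<in> path_edges (L c). \<chi> e = c})"

lemma piece_system_insert:
  assumes "piece_system \<chi> V C S L" "c \<in> C" "c \<notin> S" "pair_piece \<chi> c l" "set l \<subseteq> V"
    "set l \<inter> covered S L = {}"
  shows "piece_system \<chi> V C (insert c S) (L(c := l))"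
  using assms unfolding piece_system_def covered_def by (auto simp: Int_commute)

lemma piece_system_subset: "piece_system \<chi> V C S L \<Longrightarrow> S' \<subseteq> S \<Longrightarrow> piece_system \<chi> V C S' L"
  unfolding piece_system_def by blast

lemma cherry_pair_piece:
  assumes "distinct [u, x, w]" "\<chi> {x, u} = c" "\<chi> {x, w} = c"
  shows "pair_piece \<chi> c [u, x, w]"
  unfolding pair_piece_def using assms
  by (intro conjI exI[of _ "{u, x}"] exI[of _ "{x, w}"]) (auto simp: doubleton_eq_iff insert_commute)

lemma star_pair_piece:
  assumes "distinct [u, x, w, y]" "\<chi> {x, u} = c" "\<chi> {x, w} = c"
  shows "pair_piece \<chi> c [u, x, w, y]"
  unfolding pair_piece_def using assms
  by (intro conjI exI[of _ "{u, x}"] exI[of _ "{x, w}"]) (auto simp: doubleton_eq_iff insert_commute)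

text \<open>The disjoint pieces, strung together and followed by the uncovered vertices, form a
  Hamilton path.\<close>

lemma linear_forest_system:
  assumes "piece_system \<chi> V C S L" "finite V" "finite S"
  shows "linear_forest V (system_forest \<chi> S L)"
proof -
  obtain cs where cs: "set cs = S" "distinct cs" using assms finite_distinct_list by blast
  obtain ws where ws: "set ws = V - covered S L" "distinct ws"
    using assms finite_distinct_list[of "V - covered S L"] by auto
  have "distinct (concat (map L cs))"
  proof -
    have "\<forall>c\<in>set cs. distinct (L c)"
      "\<forall>c\<in>set cs. \<forall>d\<in>set cs. c \<noteq> d \<longrightarrow> set (L c) \<inter> set (L d) = {}"
      using assms(1) cs(1) unfolding piece_system_def pair_piece_def by blast+
    then show ?thesis using cs(2) by (induction cs) fastforce+
  qed
  moreover have "set (concat (map L cs)) = covered S L" using cs unfolding covered_def by auto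
  moreover have "covered S L \<subseteq> V" using assms unfolding covered_def piece_system_def by auto
  ultimately have "distinct (concat (map L cs) @ ws)" "set (concat (map L cs) @ ws) = V"
    using ws by auto
  moreover have "system_forest \<chi> S L \<subseteq> path_edges (concat (map L cs) @ ws)"
  proof
    fix e assume "e \<in> system_forest \<chi> S L"
    then obtain c where "c \<in> S" "e \<in> path_edges (L c)" unfolding system_forest_def by auto
    then show "e \<in> path_edges (concat (map L cs) @ ws)"
      using path_edges_concat[of "L c" "map L cs"] cs
        path_edges_append_supset[of "concat (map L cs)" ws] by auto
  qed
  ultimately show ?thesis unfolding linear_forest_def by blast
qed

lemma card_covered_le:
  assumes "piece_system \<chi> V C S L" "finite S"
  shows "card (covered S L) \<le> 4 * card S"
proof -
  have "card (set (L c)) \<le> 4" if "c \<in> S" for c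
    using assms(1) that card_length[of "L c"] unfolding piece_system_def pair_piece_def
    by (meson le_trans)
  then show ?thesis unfolding covered_def
    using card_UN_le[OF assms(2), of "\<lambda>c. set (L c)"] sum_mono[of S "\<lambda>c. card (set (L c))" "\<lambda>_. 4"]
    by (simp add: mult.commute)
qed

text \<open>The centre carries two forest edges of colour \<open>d\<close>, so \<open>v\<close> is
  one of the three leaves, and the centre with the other two is still a piece. This frees
  \<open>v\<close> without giving up \<open>d\<close>.\<close>

lemma star_piece_leaf:
  assumes "star_piece \<chi> d l" "distinct l" "v \<in> set l" "low_degree {e \<in> path_edges l. \<chi> e = d} v"
  obtains u x w where "pair_piece \<chi> d [u, x, w]" "{u, x, w} = set l - {v}"
proof -
  obtain u x w y where l: "l = [u, x, w, y]" and \<chi>: "\<chi> {x, u} = d" "\<chi> {x, w} = d" "\<chi> {x, y} = d"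
    using assms unfolding star_piece_def by blast
  have d: "distinct [u, x, w, y]" using assms l by simp
  have "v \<noteq> x"
  proof
    assume "v = x"
    have "{x, u} \<in> {e \<in> path_edges l. \<chi> e = d}" "{x, w} \<in> {e \<in> path_edges l. \<chi> e = d}"
      using \<chi> unfolding l by (auto simp: insert_commute)
    then have "{x, u} = {x, w}" by (rule low_degreeD[OF assms(4)]) (simp_all add: \<open>v = x\<close>)
    then show False using d by (auto simp: doubleton_eq_iff)
  qed
  then consider "v = u" | "v = w" | "v = y" using assms(3) l by auto
  then show thesis
  proof cases
    case 1
    then show ?thesis
      by (intro that[of w x y] cherry_pair_piece) (use d \<chi> l in auto)
  next
    case 2
    then show ?thesis
      by (intro that[of u x y] cherry_pair_piece) (use d \<chi> l in auto)
  next
    case 3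
    then show ?thesis
      by (intro that[of u x w] cherry_pair_piece) (use d \<chi> l in auto)
  qed
qed

text \<open>In a maximal system, suppose that such a \<open>v\<close> sends three edges of colour
  \<open>c\<close> to uncovered vertices; they form a star piece. If \<open>v\<close> is uncovered,
  the star can be added; if \<open>v\<close> is on a star piece, it is a leaf and can be released
  first. Both enlarge \<open>S\<close>. If \<open>v\<close> is on another piece, trading that piece
  for the star keeps \<open>card S\<close> and gains a star.\<close>

lemma optimal_piece_system:
  assumes "finite C"
  obtains S L where "piece_system \<chi> V C S L"
    "\<forall>v\<in>V. \<forall>c\<in>C - S. low_degree (system_forest \<chi> S L) v \<longrightarrow>
       card {w \<in> V - covered S L. w \<noteq> v \<and> \<chi> {v, w} = c} \<le> 2"
proof -
  define stars where "stars S L = {c \<in> S. star_piece \<chi> c (L c)}" for S L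
  \<comment> \<open>The factor exceeds every possible number of stars, so weights compare
    \<open>card S\<close> first and stars second.\<close>
  define weight where "weight = (\<lambda>(S, L). card S * Suc (card C) + card (stars S L))"
  have card_le: "card S \<le> card C" "card (stars S L) \<le> card C" "finite S" "finite (stars S L)"
    if "piece_system \<chi> V C S L" for S L
    using that assms unfolding piece_system_def stars_def
    by (auto intro!: card_mono intro: finite_subset)
  have bound: "weight (S, L) < Suc (card S) * Suc (card C)" if "piece_system \<chi> V C S L" for S L
    unfolding weight_def using card_le[OF that] by simp
  have "\<exists>M. (case M of (S, L) \<Rightarrow> piece_system \<chi> V C S L) \<and>
    (\<forall>M'. (case M' of (S, L) \<Rightarrow> piece_system \<chi> V C S L) \<longrightarrow> weight M' \<le> weight M)"
  proof (rule ex_has_greatest_nat)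
    show "case ({}, \<lambda>_. []) of (S, L) \<Rightarrow> piece_system \<chi> V C S L"
      unfolding piece_system_def by simp
    show "\<forall>M. (case M of (S, L) \<Rightarrow> piece_system \<chi> V C S L) \<longrightarrow>
        weight M < Suc (card C) * Suc (card C)"
    proof clarify
      fix S L assume sys: "piece_system \<chi> V C S L"
      have "weight (S, L) < Suc (card S) * Suc (card C)" by (rule bound[OF sys])
      also have "\<dots> \<le> Suc (card C) * Suc (card C)"
        using card_le(1)[OF sys] by (intro mult_le_mono1) simp
      finally show "weight (S, L) < Suc (card C) * Suc (card C)" .
    qed
  qed
  then obtain S L where sys: "piece_system \<chi> V C S L"
    and max: "\<And>S' L'. piece_system \<chi> V C S' L' \<Longrightarrow> weight (S', L') \<le> weight (S, L)"
    by auto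
  note fin = card_le[OF sys]
  have no_gain: "card S' \<le> card S" if "piece_system \<chi> V C S' L'" for S' L'
  proof (rule ccontr)
    assume "\<not> ?thesis"
    then have "Suc (card S) * Suc (card C) \<le> card S' * Suc (card C)"
      by (intro mult_le_mono1) simp
    also have "\<dots> \<le> weight (S', L')" unfolding weight_def by simp
    finally show False using max[OF that] bound[OF sys] by linarith
  qed
  show thesis
  proof (rule that[OF sys], intro ballI impI, rule ccontr)
    fix v c
    assume v: "v \<in> V" "low_degree (system_forest \<chi> S L) v" and c: "c \<in> C - S"
      and many: "\<not> card {w \<in> V - covered S L. w \<noteq> v \<and> \<chi> {v, w} = c} \<le> 2"
    from many obtain x y z where xyz: "x \<in> V - covered S L" "y \<in> V - covered S L"
      "z \<in> V - covered S L" "distinct [x, v, y, z]"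
      and \<chi>: "\<chi> {v, x} = c" "\<chi> {v, y} = c" "\<chi> {v, z} = c"
      by (rule card_gt_2E) auto
    \<comment> \<open>The second entry is the centre of the star, the last one its spare
      leaf.\<close>
    let ?l = "[x, v, y, z]"
    have piece: "pair_piece \<chi> c ?l" using xyz \<chi> by (intro star_pair_piece) auto
    have star: "star_piece \<chi> c ?l" using \<chi> unfolding star_piece_def by auto
    have lV: "set ?l \<subseteq> V" using xyz v by auto
    show False
    proof (cases "v \<in> covered S L")
      case False
      then have "piece_system \<chi> V C (insert c S) (L(c := ?l))"
        using sys c piece lV xyz by (intro piece_system_insert) auto
      from no_gain[OF this] show False using c fin by simp
    next
      case True
      then obtain d where d: "d \<in> S" "v \<in> set (L d)" unfolding covered_def by auto
      have cd: "c \<noteq> d" using c d by auto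
      have Ld: "pair_piece \<chi> d (L d)" "set (L d) \<subseteq> V" using sys d unfolding piece_system_def by auto
      have sys_d: "piece_system \<chi> V C (S - {d}) L"
        using sys piece_system_subset by blast
      have disj: "set (L d) \<inter> covered (S - {d}) L = {}"
        using sys d unfolding piece_system_def covered_def by blast
      have cov: "covered (S - {d}) L \<subseteq> covered S L" unfolding covered_def by auto
      show False
      proof (cases "star_piece \<chi> d (L d)")
        case True
        have "{e \<in> path_edges (L d). \<chi> e = d} \<subseteq> system_forest \<chi> S L"
          using d unfolding system_forest_def by auto
        then have "low_degree {e \<in> path_edges (L d). \<chi> e = d} v"
          by (rule low_degree_mono[OF v(2)])
        moreover have "distinct (L d)" using Ld unfolding pair_piece_def by simp
        ultimately obtain p q r where pqr: "pair_piece \<chi> d [p, q, r]" "{p, q, r} = set (L d) - {v}"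
          using star_piece_leaf[OF True _ d(2)] by blast
        let ?L = "L(d := [p, q, r])"
        have sub: "set [p, q, r] \<subseteq> set (L d) - {v}" using pqr by simp
        have "piece_system \<chi> V C (insert d (S - {d})) ?L"
          using sys_d pqr(1) Ld(2) disj sub d sys
          by (intro piece_system_insert) (auto simp: piece_system_def)
        then have sys': "piece_system \<chi> V C S ?L" using d by (simp add: insert_absorb)
        have "covered S ?L = covered (S - {d}) L \<union> (set (L d) - {v})"
          unfolding pqr(2)[symmetric] using d(1) unfolding covered_def by (auto split: if_splits)
        moreover have "set (L d) \<subseteq> covered S L" using d unfolding covered_def by auto
        moreover have "v \<notin> covered (S - {d}) L" using disj d(2) by auto
        ultimately have "covered S ?L \<subseteq> covered S L - {v}"
          using cov by blast
        then have "set ?l \<inter> covered S ?L = {}" using xyz by auto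
        then have "piece_system \<chi> V C (insert c S) (?L(c := ?l))"
          using c piece lV by (intro piece_system_insert[OF sys']) auto
        from no_gain[OF this] show False using c fin by simp
      next
        case False
        let ?S = "insert c (S - {d})" and ?L = "L(c := ?l)"
        have "set ?l \<inter> covered (S - {d}) L = {}" using xyz disj d(2) cov by auto
        then have sys': "piece_system \<chi> V C ?S ?L"
          using c piece lV by (intro piece_system_insert[OF sys_d]) auto
        have "card ?S = Suc (card (S - {d}))" using c fin by (intro card_insert_disjoint) auto
        also have "\<dots> = card S" using fin(3) d(1) by (rule card_Suc_Diff1)
        finally have "card ?S = card S" .
        \<comment> \<open>The piece given up for \<open>d\<close> is not a star, so no star is
          lost.\<close>
        moreover have "stars ?S ?L = insert c (stars S L)"
          using False star c unfolding stars_def by auto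
        moreover have "c \<notin> stars S L" using c unfolding stars_def by auto
        ultimately have "weight (?S, ?L) = Suc (weight (S, L))"
          using fin unfolding weight_def by simp
        then show False using max[OF sys'] by simp
      qed
    qed
  qed
qed

section \<open>The lower bound\<close>

lemma hamilton_cycle_without_unique_color:
  assumes "finite V" "2 \<le> card V" "finite C" "4 * card C \<le> card V"
  shows "\<exists>xs. distinct xs \<and> set xs = V \<and> (\<forall>c\<in>C. \<not> unique_color \<chi> (cycle_edges xs) c)"
proof -
  obtain S L where sys: "piece_system \<chi> V C S L"
    and few: "\<forall>v\<in>V. \<forall>c\<in>C - S. low_degree (system_forest \<chi> S L) v \<longrightarrow>
       card {w \<in> V - covered S L. w \<noteq> v \<and> \<chi> {v, w} = c} \<le> 2"
    by (rule optimal_piece_system[OF assms(3), of \<chi> V])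
  have SC: "S \<subseteq> C" using sys unfolding piece_system_def by simp
  then have finS: "finite S" using assms finite_subset by blast
  have covV: "covered S L \<subseteq> V" using sys unfolding piece_system_def covered_def by auto
  let ?F = "system_forest \<chi> S L"
  have "\<exists>xs. distinct xs \<and> set xs = V \<and> ?F \<subseteq> cycle_edges xs \<and>
    (\<forall>c\<in>C - S. \<not> unique_color \<chi> (cycle_edges xs) c)"
  proof (rule extend_to_hamilton_cycle)
    show "linear_forest V ?F" using linear_forest_system[OF sys] assms finS by blast
    show "isolated_in ?F w" if "w \<in> V - covered S L" for w
      using that unfolding isolated_in_def system_forest_def covered_def
      by (auto dest: path_edges_subset)
    \<comment> \<open>The pieces cover at most \<open>4 * card S\<close> vertices, so the bound
      \<open>4 * card C \<le> card V\<close> passes on to the uncovered vertices and the remaining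
      colours.\<close>
    have "card (V - covered S L) = card V - card (covered S L)"
      using covV assms finite_subset by (intro card_Diff_subset) auto
    then show "4 * card (C - S) \<le> card (V - covered S L)"
      using card_covered_le[OF sys finS] card_Diff_subset[OF finS SC] assms(4) by simp
    show "\<chi> e \<notin> C - S" if "e \<in> ?F" for e using that unfolding system_forest_def by auto
  qed (use assms few in auto)
  then obtain xs where xs: "distinct xs" "set xs = V" "?F \<subseteq> cycle_edges xs"
    "\<forall>c\<in>C - S. \<not> unique_color \<chi> (cycle_edges xs) c" by blast
  have "\<not> unique_color \<chi> (cycle_edges xs) c" if "c \<in> S" for c
  proof -
    obtain e f where ef: "e \<noteq> f" "e \<in> path_edges (L c)" "f \<in> path_edges (L c)" "\<chi> e = c" "\<chi> f = c"
      using sys \<open>c \<in> S\<close> unfolding piece_system_def pair_piece_def by meson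
    then have "e \<in> ?F" "f \<in> ?F" using that unfolding system_forest_def by auto
    then show ?thesis using xs(3) ef by (intro not_unique_colorI[of e _ f]) auto
  qed
  then show ?thesis using xs by blast
qed

section \<open>From vertex lists to copies of the cycle graph\<close>

lemma is_copy_cycle_graph:
  assumes "distinct xs" "set xs = {..<n}" "2 \<le> n"
  shows "is_copy (cycle_graph n) (complete_graph n) \<lparr>vertices = {..<n}, edges = cycle_edges xs\<rparr>"
proof -
  have len: "length xs = n" using assms distinct_card by fastforce
  then have "xs \<noteq> []" using assms(3) by auto
  then have E: "cycle_edges xs = {{xs ! i, xs ! ((i + 1) mod n)} | i. i < n}"
    unfolding len[symmetric] by (rule cycle_edges_conv_nth)
  have "cycle_edges xs \<subseteq> edges (complete_graph n)"
  proof
    fix e assume "e \<in> cycle_edges xs"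
    then obtain i where i: "i < n" "e = {xs ! i, xs ! ((i + 1) mod n)}" unfolding E by auto
    have m: "(i + 1) mod n < n" using assms by simp
    have "i \<noteq> (i + 1) mod n"
      using i(1) assms(3) by (cases "i + 1 = n") auto
    then have "xs ! i \<noteq> xs ! ((i + 1) mod n)"
      using assms(1) len i(1) m by (simp add: nth_eq_iff_index_eq)
    moreover have "xs ! i < n" "xs ! ((i + 1) mod n) < n"
      using assms(2) len i(1) m nth_mem by blast+
    ultimately show "e \<in> edges (complete_graph n)"
      using i unfolding complete_graph_def by auto
  qed
  \<comment> \<open>The isomorphism from the cycle graph sends \<open>i\<close> to
    \<open>xs ! i\<close>.\<close>
  moreover have "bij_betw ((!) xs) {..<n} {..<n}"
    using bij_betw_nth[OF assms(1)] len assms(2) by auto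
  moreover have "cycle_edges xs = (\<lambda>e. (!) xs ` e) ` edges (cycle_graph n)"
    unfolding E cycle_graph_def by (auto simp: image_Collect) (metis image_insert image_empty)+
  ultimately show ?thesis
    unfolding is_copy_def subgraph_def graph_iso_def
    by (auto simp: complete_graph_def cycle_graph_def)
qed

text \<open>The \<open>LEAST\<close> has its defining property once some \<open>r\<close> qualifies.
  An injective colouring provides one: each copy of \<open>H\<close> has an edge, and its colour
  occurs on no other edge.\<close>

lemma unique_ramsey_attained:
  fixes H :: "'a ugraph"
  assumes "edges H \<noteq> {}"
  shows "0 < unique_ramsey n H \<and>
    (\<exists>\<chi>. edge_coloring (unique_ramsey n H) (complete_graph n) \<chi> \<and>
       (\<forall>F. is_copy H (complete_graph n) F \<longrightarrow> has_unique_color \<chi> F))"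
  unfolding unique_ramsey_def
proof (rule LeastI_ex)
  have "edges (complete_graph n) \<subseteq> Pow {..<n}" unfolding complete_graph_def by auto
  then have fin: "finite (edges (complete_graph n))" using finite_subset by blast
  define m where "m = card (edges (complete_graph n))"
  obtain g where g: "bij_betw g (edges (complete_graph n)) {0..<m}"
    using ex_bij_betw_finite_nat[OF fin] m_def by auto
  let ?\<chi> = "\<lambda>e. Suc (g e)"
  \<comment> \<open>The colours lie in \<open>{1..m}\<close>; the bound \<open>Suc m\<close> is
    positive even if \<open>m = 0\<close>.\<close>
  have "edge_coloring (Suc m) (complete_graph n) ?\<chi>"
    using bij_betwE[OF g] unfolding edge_coloring_def by (auto simp: Suc_le_eq)
  moreover have "has_unique_color ?\<chi> F" if "is_copy H (complete_graph n) F" for F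
  proof -
    have sub: "edges F \<subseteq> edges (complete_graph n)"
      using that unfolding is_copy_def subgraph_def by simp
    obtain e where e: "e \<in> edges F"
      using \<open>is_copy H _ F\<close> assms unfolding is_copy_def graph_iso_def by fastforce
    have "f = e" if "f \<in> edges F" "?\<chi> f = ?\<chi> e" for f
      using that e sub g unfolding bij_betw_def inj_on_def by auto
    then show ?thesis unfolding has_unique_color_def using e by blast
  qed
  ultimately show "\<exists>r>0. \<exists>\<chi>. edge_coloring r (complete_graph n) \<chi> \<and>
      (\<forall>F. is_copy H (complete_graph n) F \<longrightarrow> has_unique_color \<chi> F)"
    by blast
qed

theorem theorem1p5:
  fixes n :: nat
  assumes "n \<ge> 4"
  shows "real (unique_ramsey n (cycle_graph n)) > real n / 4"
proof (rule ccontr)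
  define r where "r = unique_ramsey n (cycle_graph n)"
  assume "\<not> ?thesis"
  \<comment> \<open>This is the counting hypothesis \<open>4 * card C \<le> card V\<close> for the
    colour set \<open>{1..r}\<close> and the vertex set \<open>{..<n}\<close>.\<close>
  then have rn: "4 * r \<le> n" unfolding r_def by linarith
  have "edges (cycle_graph n) \<noteq> {}" using assms unfolding cycle_graph_def by (auto intro: exI[of _ 0])
  from unique_ramsey_attained[OF this, of n] obtain \<chi>
    where \<chi>: "edge_coloring r (complete_graph n) \<chi>"
    and unique: "\<And>F. is_copy (cycle_graph n) (complete_graph n) F \<Longrightarrow> has_unique_color \<chi> F"
    unfolding r_def by blast
  obtain xs where xs: "distinct xs" "set xs = {..<n}"
    and no_unique: "\<forall>c\<in>{1..r}. \<not> unique_color \<chi> (cycle_edges xs) c"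
    using hamilton_cycle_without_unique_color[of "{..<n}" "{1..r}" \<chi>] assms rn by auto
  let ?F = "\<lparr>vertices = {..<n}, edges = cycle_edges xs\<rparr>"
  have copy: "is_copy (cycle_graph n) (complete_graph n) ?F"
    using is_copy_cycle_graph[OF xs] assms by simp
  obtain c where c: "unique_color \<chi> (cycle_edges xs) c"
    using unique[OF copy] unfolding has_unique_color_def unique_color_def by auto
  have "\<chi> e \<in> {1..r}" if "e \<in> cycle_edges xs" for e
    using \<chi> copy that unfolding edge_coloring_def is_copy_def subgraph_def by auto
  \<comment> \<open>A colour occurring exactly once is attained on the cycle, hence lies in
    \<open>{1..r}\<close>, where the cycle has no such colour.\<close>
  then show False using c no_unique by (metis unique_colorE)
qed

end
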